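(* Let $G$ be a group and let $H \leq G$ be a commensurated subgroup. Assume that $G$ is generated by finitely many cosets of $H$. Let $\widetilde{H}$ be the residual closure of $H$ in $G$ and put $$N := \bigcap_{g \in G} g \widetilde{H} g^{-1}.$$ Then $N$ has finite index in $\widetilde{H}$. Additionally, $N$ is a normal subgroup of $G$ such that $[H : N \cap H] < \infty$, $N = \widetilde{N \cap H}$ (the residual closure of $N \cap H$ in $G$), and $\widetilde{H} = NH$.
   Context: A subgroup $H$ of a group $G$ is commensurated if $[H : H \cap gHg^{-1}] < \infty$ for all $g \in G$. "$G$ is generated by finitely many cosets of $H$" means that there is a finite subset $Y \subseteq G$ with $G = \langle YH \rangle$. A subgroup $J \leq G$ is virtually normal if there is a subgroup $K \leq J$ of finite index in $J$ that is normal in $G$. A subgroup is weakly separable if it is an intersection of virtually normal subgroups of $G$. For a subgroup $H \leq G$, the residual closure $\widetilde{H}$ of $H$ in $G$ is the unique smallest weakly separable subgroup of $G$ containing $H$, i.e. the intersection of all virtually normal subgroups of $G$ containing $H$. *)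

theory Defs
  imports "HOL-Algebra.Coset" "HOL-Algebra.Generated_Groups"
begin

definition conj_set :: "('a, 'b) monoid_scheme \<Rightarrow> 'a \<Rightarrow> 'a set \<Rightarrow> 'a set" where
  "conj_set G g J = (g <#\<^bsub>G\<^esub> J) #>\<^bsub>G\<^esub> (inv\<^bsub>G\<^esub> g)"

text \<open>The index [J : K] is finite. It is stated through finiteness of the set of cosets because
  \<^const>\<open>card\<close> is 0 on infinite sets.\<close>

definition finite_index :: "('a, 'b) monoid_scheme \<Rightarrow> 'a set \<Rightarrow> 'a set \<Rightarrow> bool" where
  "finite_index G K J \<longleftrightarrow>
     subgroup J G \<and> subgroup K G \<and> K \<subseteq> J \<and> finite (rcosets\<^bsub>G\<lparr>carrier := J\<rparr>\<^esub> K)"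

definition commensurated :: "('a, 'b) monoid_scheme \<Rightarrow> 'a set \<Rightarrow> bool" where
  "commensurated G H \<longleftrightarrow>
     subgroup H G \<and> (\<forall>g\<in>carrier G. finite_index G (H \<inter> conj_set G g H) H)"

definition generated_by_finitely_many_cosets :: "('a, 'b) monoid_scheme \<Rightarrow> 'a set \<Rightarrow> bool" where
  "generated_by_finitely_many_cosets G H \<longleftrightarrow>
     (\<exists>Y. finite Y \<and> Y \<subseteq> carrier G \<and> carrier G = generate G (Y <#>\<^bsub>G\<^esub> H))"

definition virtually_normal :: "('a, 'b) monoid_scheme \<Rightarrow> 'a set \<Rightarrow> bool" where
  "virtually_normal G J \<longleftrightarrow> subgroup J G \<and> (\<exists>K. K \<lhd> G \<and> finite_index G K J)"

text \<open>The empty intersection would be the group itself, which is virtually normal, so nothing is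
  lost by requiring the family to be nonempty.\<close>

definition weakly_separable :: "('a, 'b) monoid_scheme \<Rightarrow> 'a set \<Rightarrow> bool" where
  "weakly_separable G J \<longleftrightarrow>
     (\<exists>\<J>. \<J> \<noteq> {} \<and> (\<forall>L\<in>\<J>. virtually_normal G L) \<and> J = \<Inter>\<J>)"

definition residual_closure :: "('a, 'b) monoid_scheme \<Rightarrow> 'a set \<Rightarrow> 'a set" where
  "residual_closure G H = \<Inter>{J. virtually_normal G J \<and> H \<subseteq> J}"

lemma (in group) virtually_normal_carrier: "virtually_normal G (carrier G)"
proof -
  have "rcosets (carrier G) \<subseteq> {carrier G}"
    unfolding RCOSETS_def by (simp add: coset_join2 subgroup_self)
  then have "finite (rcosets (carrier G))"
    by (rule finite_subset) simp
  then have "finite_index G (carrier G) (carrier G)"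
    by (simp add: finite_index_def subgroup_self)
  moreover have "carrier G \<lhd> G"
    by (rule normal_invI[OF subgroup_self]) simp
  ultimately show ?thesis
    unfolding virtually_normal_def using subgroup_self by blast
qed

text \<open>For a subgroup, the residual closure is the smallest weakly separable subgroup containing
  it.\<close>

lemma (in group) residual_closure_least:
  assumes "subgroup H G"
  shows "subgroup (residual_closure G H) G"
    and "weakly_separable G (residual_closure G H)"
    and "H \<subseteq> residual_closure G H"
    and "\<And>J. weakly_separable G J \<Longrightarrow> H \<subseteq> J \<Longrightarrow> residual_closure G H \<subseteq> J"
proof -
  have ne: "{J. virtually_normal G J \<and> H \<subseteq> J} \<noteq> {}"
    using virtually_normal_carrier subgroup.subset[OF assms] by blast
  show "subgroup (residual_closure G H) G"
    unfolding residual_closure_def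
    by (rule subgroups_Inter[OF _ ne]) (auto simp: virtually_normal_def)
  show "weakly_separable G (residual_closure G H)"
    unfolding residual_closure_def weakly_separable_def
    by (rule exI[of _ "{J. virtually_normal G J \<and> H \<subseteq> J}"]) (use ne in simp)
  show "H \<subseteq> residual_closure G H"
    unfolding residual_closure_def by blast
  show "residual_closure G H \<subseteq> J" if ws: "weakly_separable G J" and "H \<subseteq> J" for J
  proof -
    obtain \<J> where "\<forall>L\<in>\<J>. virtually_normal G L" and J: "J = \<Inter>\<J>"
      using ws unfolding weakly_separable_def by auto
    with \<open>H \<subseteq> J\<close> have "\<J> \<subseteq> {L. virtually_normal G L \<and> H \<subseteq> L}"
      by auto
    then show ?thesis
      unfolding residual_closure_def J by (rule Inter_anti_mono)
  qed
qed

end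

theory Submission
  imports Defs "HOL-Algebra.Zassenhaus"
begin

text \<open>Put \<open>L = residual_closure G H\<close>. It is the intersection of the subgroups \<open>K <#> H\<close>, where
  \<open>K\<close> runs over the normal subgroups of \<open>G\<close> meeting \<open>H\<close> in finite index; these \<open>K\<close> are closed under
  finite intersection. As \<open>H\<close> is commensurated, for each \<open>y\<close> finitely many coset representatives
  decide whether an element of \<open>L\<close> lies in \<open>y <# L #> inv y\<close>, so that \<open>L \<inter> K \<subseteq> y <# L #> inv y\<close> for a small
  enough \<open>K\<close>. One \<open>K\<close> serves all of the finitely many coset generators and their inverses, which
  makes \<open>L \<inter> K\<close> normal in \<open>G\<close>; it has finite index in \<open>L \<subseteq> K <#> H\<close>.\<close>

context group
begin

section \<open>Finite index through coset representatives\<close>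

lemma inv_mult_cancel:
  assumes "x \<in> carrier G" "y \<in> carrier G"
  shows "inv x \<otimes> (x \<otimes> y) = y" and "x \<otimes> (inv x \<otimes> y) = y"
  using assms by (simp_all flip: m_assoc)

text \<open>The right cosets of \<open>x\<close> and \<open>f\<close> agree exactly when
  \<open>x \<otimes> inv f \<in> K\<close>, so the finite set of cosets can be traded for a finite,
  possibly redundant, set \<open>F\<close> of representatives. Later index arguments are
  calculations with such an \<open>F\<close>.\<close>

lemma finite_index_iff_transversal:
  assumes J: "subgroup J G" and K: "subgroup K G" and "K \<subseteq> J"
  shows "finite_index G K J \<longleftrightarrow>
    (\<exists>F. finite F \<and> F \<subseteq> J \<and> (\<forall>x\<in>J. \<exists>f\<in>F. x \<otimes> inv f \<in> K))"
proof -
  have rc: "rcosets\<^bsub>G\<lparr>carrier := J\<rparr>\<^esub> K = (\<lambda>a. K #> a) ` J"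
    by (auto simp: RCOSETS_def r_coset_def)
  have JG: "J \<subseteq> carrier G" and KG: "K \<subseteq> carrier G"
    using J K subgroup.subset by auto
  have eq: "K #> x = K #> f \<longleftrightarrow> x \<otimes> inv f \<in> K" if "x \<in> J" "f \<in> J" for x f
  proof
    assume "K #> x = K #> f"
    then have "x \<in> K #> f"
      using rcos_self[OF _ K] that JG by blast
    then show "x \<otimes> inv f \<in> K"
      using that JG K subgroup.rcos_module_imp[OF K is_group] by blast
  next
    assume "x \<otimes> inv f \<in> K"
    then have "x \<in> K #> f"
      using that JG subgroup.rcos_module_rev[OF K is_group] by blast
    then show "K #> x = K #> f"
      using repr_independence[OF _ _ K] that JG by blast
  qed
  \<comment> \<open>A finite image of \<open>J\<close> is already the image of a finite subset of
    \<open>J\<close>.\<close>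
  have "finite ((\<lambda>a. K #> a) ` J) \<longleftrightarrow>
      (\<exists>F. finite F \<and> F \<subseteq> J \<and> (\<lambda>a. K #> a) ` J = (\<lambda>a. K #> a) ` F)"
    by (metis finite_imageI finite_subset_image order_refl)
  also have "\<dots> \<longleftrightarrow> (\<exists>F. finite F \<and> F \<subseteq> J \<and> (\<forall>x\<in>J. \<exists>f\<in>F. x \<otimes> inv f \<in> K))"
  proof (intro ex_cong1 conj_cong refl)
    fix F assume FJ: "F \<subseteq> J"
    have "(\<lambda>a. K #> a) ` J = (\<lambda>a. K #> a) ` F \<longleftrightarrow> (\<lambda>a. K #> a) ` J \<subseteq> (\<lambda>a. K #> a) ` F"
      using image_mono[OF FJ, of "\<lambda>a. K #> a"] by (simp add: set_eq_subset)
    also have "\<dots> \<longleftrightarrow> (\<forall>x\<in>J. \<exists>f\<in>F. K #> x = K #> f)"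
      by (simp add: image_subset_iff image_iff)
    also have "\<dots> \<longleftrightarrow> (\<forall>x\<in>J. \<exists>f\<in>F. x \<otimes> inv f \<in> K)"
      by (intro ball_cong bex_cong refl eq) (use FJ in auto)
    finally show "(\<lambda>a. K #> a) ` J = (\<lambda>a. K #> a) ` F \<longleftrightarrow> (\<forall>x\<in>J. \<exists>f\<in>F. x \<otimes> inv f \<in> K)" .
  qed
  finally show ?thesis
    using assms by (simp add: finite_index_def rc)
qed

lemma finite_indexI:
  assumes "subgroup J G" "subgroup K G" "K \<subseteq> J" "finite F" "F \<subseteq> J"
    and "\<And>x. x \<in> J \<Longrightarrow> \<exists>f\<in>F. x \<otimes> inv f \<in> K"
  shows "finite_index G K J"
  unfolding finite_index_iff_transversal[OF assms(1-3)] using assms(4-6) by (intro exI[of _ F]) simp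

lemma finite_indexE:
  assumes "finite_index G K J"
  obtains F where "subgroup J G" "subgroup K G" "K \<subseteq> J" "finite F" "F \<subseteq> J"
    "\<And>x. x \<in> J \<Longrightarrow> \<exists>f\<in>F. x \<otimes> inv f \<in> K"
proof -
  have "subgroup J G" "subgroup K G" "K \<subseteq> J"
    using assms by (auto simp: finite_index_def)
  moreover from this obtain F where "finite F" "F \<subseteq> J" "\<forall>x\<in>J. \<exists>f\<in>F. x \<otimes> inv f \<in> K"
    using assms by (auto simp: finite_index_iff_transversal)
  ultimately show thesis
    using that[of F] by blast
qed

lemma mult_inv_cancel_middle:
  assumes "x \<in> carrier G" "y \<in> carrier G" "f \<in> carrier G"
  shows "(x \<otimes> inv f) \<otimes> inv (y \<otimes> inv f) = x \<otimes> inv y"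
  using assms by (simp add: inv_mult_group m_assoc inv_mult_cancel)

text \<open>The representatives in \<open>F\<close> for \<open>J\<close> modulo \<open>K\<close> may
  lie outside \<open>A\<close>. Each coset that meets \<open>A\<close> gets a new representative
  inside \<open>A\<close>; the other cosets contain no element of \<open>A\<close>.\<close>

lemma finite_index_Int:
  assumes KJ: "finite_index G K J" and A: "subgroup A G" and "A \<subseteq> J"
  shows "finite_index G (A \<inter> K) A"
proof -
  obtain F where J: "subgroup J G" and K: "subgroup K G" and F: "finite F" "F \<subseteq> J"
      "\<And>x. x \<in> J \<Longrightarrow> \<exists>f\<in>F. x \<otimes> inv f \<in> K"
    using KJ by (rule finite_indexE) blast
  define rep where "rep f = (SOME a. a \<in> A \<and> a \<otimes> inv f \<in> K)" for f
  \<comment> \<open>\<open>F'\<close> singles out the \<open>f\<close> whose coset meets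
    \<open>A\<close>, so that the choice in \<open>rep f\<close> has a witness.\<close>
  define F' where "F' = {f \<in> F. \<exists>a. a \<in> A \<and> a \<otimes> inv f \<in> K}"
  have rep: "rep f \<in> A \<and> rep f \<otimes> inv f \<in> K" if "f \<in> F'" for f
    unfolding rep_def by (rule someI_ex) (use that in \<open>auto simp: F'_def\<close>)
  show ?thesis
  proof (rule finite_indexI[OF A, of _ "rep ` F'"])
    show "subgroup (A \<inter> K) G"
      using A K by (rule subgroups_Inter_pair)
    show "finite (rep ` F')"
      using F by (simp add: F'_def)
    show "rep ` F' \<subseteq> A"
      using rep by blast
    fix x assume x: "x \<in> A"
    then obtain f where f: "f \<in> F" "x \<otimes> inv f \<in> K"
      using F \<open>A \<subseteq> J\<close> by blast
    with x have f': "f \<in> F'"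
      by (auto simp: F'_def)
    note r = rep[OF f']
    \<comment> \<open>\<open>x\<close> and \<open>rep f\<close> both lie in the coset of
      \<open>f\<close>; in the quotient of the two, \<open>f\<close> cancels.\<close>
    have "(x \<otimes> inv f) \<otimes> inv (rep f \<otimes> inv f) \<in> K"
      using f r K by (meson subgroup.m_closed subgroup.m_inv_closed)
    moreover have "x \<in> carrier G" "rep f \<in> carrier G" "f \<in> carrier G"
      using x r f F A J by (meson subgroup.mem_carrier subsetD)+
    ultimately have "x \<otimes> inv (rep f) \<in> K"
      by (simp add: mult_inv_cancel_middle)
    moreover have "x \<otimes> inv (rep f) \<in> A"
      using x r A by (meson subgroup.m_closed subgroup.m_inv_closed)
    ultimately show "\<exists>f\<in>rep ` F'. x \<otimes> inv f \<in> A \<inter> K"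
      using f' by blast
  qed blast
qed

text \<open>Representatives multiply: if \<open>f\<close> moves \<open>x\<close> into
  \<open>J\<close> and \<open>e\<close> then moves the result into \<open>K\<close>, then
  \<open>e \<otimes> f\<close> represents \<open>x\<close> modulo \<open>K\<close>.\<close>

lemma finite_index_trans:
  assumes "finite_index G K J" and "finite_index G J I"
  shows "finite_index G K I"
proof -
  obtain E where J: "subgroup J G" and K: "subgroup K G" "K \<subseteq> J"
      and E: "finite E" "E \<subseteq> J" "\<And>x. x \<in> J \<Longrightarrow> \<exists>f\<in>E. x \<otimes> inv f \<in> K"
    using assms(1) by (rule finite_indexE) blast
  obtain F where I: "subgroup I G" and "J \<subseteq> I"
      and F: "finite F" "F \<subseteq> I" "\<And>x. x \<in> I \<Longrightarrow> \<exists>f\<in>F. x \<otimes> inv f \<in> J"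
    using assms(2) by (rule finite_indexE) blast
  show ?thesis
  proof (rule finite_indexI[OF I K(1), of "(\<lambda>(e, f). e \<otimes> f) ` (E \<times> F)"])
    show "(\<lambda>(e, f). e \<otimes> f) ` (E \<times> F) \<subseteq> I"
      using E F \<open>J \<subseteq> I\<close> I by (auto intro!: subgroup.m_closed)
    fix x assume x: "x \<in> I"
    obtain f where f: "f \<in> F" "x \<otimes> inv f \<in> J"
      using F x by blast
    obtain e where e: "e \<in> E" "x \<otimes> inv f \<otimes> inv e \<in> K"
      using E f by blast
    have "x \<in> carrier G" "f \<in> carrier G" "e \<in> carrier G"
      using x e f E F I J by (meson subgroup.mem_carrier subsetD)+
    then have "x \<otimes> inv (e \<otimes> f) = x \<otimes> inv f \<otimes> inv e"
      by (simp add: inv_mult_group m_assoc)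
    with e f show "\<exists>g\<in>(\<lambda>(e, f). e \<otimes> f) ` (E \<times> F). x \<otimes> inv g \<in> K"
      by force
  qed (use E(1) F(1) K(2) \<open>J \<subseteq> I\<close> in auto)
qed

lemma finite_index_mono:
  assumes "finite_index G K J" "subgroup K' G" "K \<subseteq> K'" "K' \<subseteq> J"
  shows "finite_index G K' J"
  using assms(1)
proof (rule finite_indexE)
  fix F assume "subgroup J G" "finite F" "F \<subseteq> J" "\<And>x. x \<in> J \<Longrightarrow> \<exists>f\<in>F. x \<otimes> inv f \<in> K"
  then show ?thesis
    using assms(2-4) by (intro finite_indexI[of J K' F]) blast+
qed

section \<open>Products with normal subgroups and the residual closure\<close>

lemma subset_mult_left:
  assumes "subgroup K G" "subgroup H G"
  shows "K \<subseteq> K <#> H"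
proof
  fix k assume "k \<in> K"
  then have "k = k \<otimes> \<one>" "\<one> \<in> H"
    using assms subgroup.mem_carrier subgroup.one_closed by fastforce+
  with \<open>k \<in> K\<close> show "k \<in> K <#> H"
    unfolding set_mult_def by blast
qed

lemma subset_mult_right:
  assumes "subgroup K G" "subgroup H G"
  shows "H \<subseteq> K <#> H"
proof
  fix h assume "h \<in> H"
  then have "h = \<one> \<otimes> h" "\<one> \<in> K"
    using assms subgroup.mem_carrier subgroup.one_closed by fastforce+
  with \<open>h \<in> H\<close> show "h \<in> K <#> H"
    unfolding set_mult_def by blast
qed

lemma subgroup_mult_least:
  assumes "subgroup J G" "K \<subseteq> J" "H \<subseteq> J"
  shows "K <#> H \<subseteq> J"
  using assms by (auto simp: set_mult_def intro: subgroup.m_closed)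

text \<open>Representatives of \<open>H\<close> modulo \<open>H \<inter> K\<close> also serve for
  \<open>K <#> H\<close> modulo \<open>K\<close>: in \<open>k \<otimes> h \<otimes> inv f\<close>
  the factor \<open>h \<otimes> inv f\<close> already lies in \<open>K\<close>. Normality of
  \<open>K\<close> makes the product a subgroup.\<close>

lemma finite_index_normal_mult:
  assumes K: "K \<lhd> G" and "finite_index G (H \<inter> K) H"
  shows "finite_index G K (K <#> H)"
proof -
  have Ks: "subgroup K G"
    using K by (rule normal_imp_subgroup)
  obtain F where H: "subgroup H G"
      and F: "finite F" "F \<subseteq> H" "\<And>x. x \<in> H \<Longrightarrow> \<exists>f\<in>F. x \<otimes> inv f \<in> H \<inter> K"
    using assms(2) by (rule finite_indexE) blast
  show ?thesis
  proof (rule finite_indexI[OF mult_norm_subgroup[OF K H] Ks, of F])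
    fix x assume "x \<in> K <#> H"
    then obtain k h where kh: "k \<in> K" "h \<in> H" "x = k \<otimes> h"
      by (auto simp: set_mult_def)
    obtain f where f: "f \<in> F" "h \<otimes> inv f \<in> K"
      using F kh by blast
    have "k \<in> carrier G" "h \<in> carrier G" "f \<in> carrier G"
      using kh f F Ks H by (meson subgroup.mem_carrier subsetD)+
    then have "x \<otimes> inv f = k \<otimes> (h \<otimes> inv f)"
      by (simp add: kh m_assoc)
    then show "\<exists>f\<in>F. x \<otimes> inv f \<in> K"
      using f kh Ks by (metis subgroup.m_closed)
  qed (use F(1,2) subset_mult_left[OF Ks H] subset_mult_right[OF Ks H] in blast)+
qed

lemma virtually_normal_mult:
  assumes "K \<lhd> G" "finite_index G (H \<inter> K) H"
  shows "virtually_normal G (K <#> H)"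
proof -
  have "finite_index G K (K <#> H)"
    using assms by (rule finite_index_normal_mult)
  moreover from this have "subgroup (K <#> H) G"
    by (simp add: finite_index_def)
  ultimately show ?thesis
    using assms(1) by (auto simp: virtually_normal_def)
qed

text \<open>The groups \<open>K <#> H\<close> are themselves virtually normal, and every virtually
  normal \<open>J\<close> containing \<open>H\<close> contains one of them: take a \<open>K\<close>
  normal in \<open>G\<close> and of finite index in \<open>J\<close>. Below, a normal
  \<open>K\<close> meeting \<open>H\<close> in finite index is called admissible.\<close>

lemma residual_closure_iff:
  assumes H: "subgroup H G"
  shows "x \<in> residual_closure G H \<longleftrightarrow>
    (\<forall>K. K \<lhd> G \<and> finite_index G (H \<inter> K) H \<longrightarrow> x \<in> K <#> H)"
    (is "?L \<longleftrightarrow> ?R")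
proof
  show ?R if ?L
  proof (intro allI impI, elim conjE)
    fix K assume K: "K \<lhd> G" "finite_index G (H \<inter> K) H"
    have "K <#> H \<in> {J. virtually_normal G J \<and> H \<subseteq> J}"
      using virtually_normal_mult[OF K] subset_mult_right[OF normal_imp_subgroup[OF K(1)] H]
      by simp
    with \<open>?L\<close> show "x \<in> K <#> H"
      unfolding residual_closure_def by (rule InterD)
  qed
  show ?L if ?R
    unfolding residual_closure_def
  proof (intro InterI, elim CollectE conjE)
    fix J assume "virtually_normal G J" "H \<subseteq> J"
    then obtain K where K: "K \<lhd> G" "finite_index G K J"
      by (auto simp: virtually_normal_def)
    then have "x \<in> K <#> H"
      using \<open>?R\<close> finite_index_Int[OF K(2) H \<open>H \<subseteq> J\<close>] by blast
    also have "K <#> H \<subseteq> J"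
      using K(2) \<open>H \<subseteq> J\<close> by (intro subgroup_mult_least) (simp_all add: finite_index_def)
    finally show "x \<in> J" .
  qed
qed

section \<open>Conjugation of elements and of sets\<close>

lemma mem_conj_set_iff:
  assumes "g \<in> carrier G" "x \<in> carrier G" "J \<subseteq> carrier G"
  shows "x \<in> conj_set G g J \<longleftrightarrow> inv g \<otimes> x \<otimes> g \<in> J"
proof
  assume "x \<in> conj_set G g J"
  then obtain j where "j \<in> J" "x = g \<otimes> j \<otimes> inv g"
    by (auto simp: conj_set_def l_coset_def r_coset_def)
  moreover from this have "inv g \<otimes> x \<otimes> g = j"
    using assms by (auto simp: m_assoc subset_iff inv_mult_cancel)
  ultimately show "inv g \<otimes> x \<otimes> g \<in> J"
    by simp
next
  assume *: "inv g \<otimes> x \<otimes> g \<in> J"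
  have "x = g \<otimes> (inv g \<otimes> x \<otimes> g) \<otimes> inv g"
    using assms by (simp add: m_assoc inv_mult_cancel)
  with * show "x \<in> conj_set G g J"
    unfolding conj_set_def l_coset_def r_coset_def by blast
qed

lemma conj_set_subset_carrier:
  assumes "g \<in> carrier G" "J \<subseteq> carrier G"
  shows "conj_set G g J \<subseteq> carrier G"
  using assms by (auto simp: conj_set_def l_coset_def r_coset_def)

lemma conj_mult:
  assumes "g \<in> carrier G" "a \<in> carrier G" "b \<in> carrier G"
  shows "inv g \<otimes> (a \<otimes> b) \<otimes> g = (inv g \<otimes> a \<otimes> g) \<otimes> (inv g \<otimes> b \<otimes> g)"
  using assms by (simp add: m_assoc inv_mult_cancel)

section \<open>Choosing one admissible subgroup for finitely many requirements\<close>

lemma normal_Int: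
  assumes "K \<lhd> G" "K' \<lhd> G"
  shows "K \<inter> K' \<lhd> G"
proof (rule normal_invI)
  show "subgroup (K \<inter> K') G"
    using assms by (intro subgroups_Inter_pair normal_imp_subgroup)
  show "g \<otimes> x \<otimes> inv g \<in> K \<inter> K'" if "g \<in> carrier G" "x \<in> K \<inter> K'" for g x
    using that normal.inv_op_closed2[OF assms(1)] normal.inv_op_closed2[OF assms(2)] by simp
qed

lemma finite_index_Int_Int:
  assumes "finite_index G (H \<inter> K) H" "finite_index G (H \<inter> K') H"
  shows "finite_index G (H \<inter> (K \<inter> K')) H"
proof -
  \<comment> \<open>The finite index of \<open>H \<inter> K'\<close> in \<open>H\<close> is
    inherited by the subgroup \<open>H \<inter> K\<close>; transitivity then leads back up to
    \<open>H\<close>.\<close>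
  have "finite_index G (H \<inter> K \<inter> (H \<inter> K')) (H \<inter> K)"
    using assms by (intro finite_index_Int[of "H \<inter> K'" H]) (auto simp: finite_index_def)
  then have "finite_index G (H \<inter> K \<inter> (H \<inter> K')) H"
    using assms(1) finite_index_trans by blast
  then show ?thesis
    by (simp add: Int_ac)
qed

text \<open>Since \<open>P f\<close> passes to smaller subgroups, the intersection of admissible
  subgroups chosen one for each \<open>f\<close> meets all requirements at once. The induction
  starts with \<open>carrier G\<close>.\<close>

lemma normal_finite_index_uniform:
  assumes "finite F" and H: "subgroup H G"
    and "\<And>f. f \<in> F \<Longrightarrow> \<exists>K. K \<lhd> G \<and> finite_index G (H \<inter> K) H \<and> P f K"
    and "\<And>f K K'. P f K \<Longrightarrow> K' \<subseteq> K \<Longrightarrow> P f K'"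
  shows "\<exists>K. K \<lhd> G \<and> finite_index G (H \<inter> K) H \<and> (\<forall>f\<in>F. P f K)"
  using assms(1,3)
proof (induction F rule: finite_induct)
  case empty
  have "carrier G \<lhd> G"
    by (rule normal_invI[OF subgroup_self]) simp
  moreover have "finite_index G (H \<inter> carrier G) H"
    using subgroup.subset[OF H] subgroup.one_closed[OF H]
    by (intro finite_indexI[OF H, of _ "{\<one>}"]) (auto simp: Int_absorb2 H)
  ultimately show ?case
    by blast
next
  case (insert f F)
  obtain K where K: "K \<lhd> G" "finite_index G (H \<inter> K) H" "\<forall>f\<in>F. P f K"
    using insert by blast
  obtain K' where K': "K' \<lhd> G" "finite_index G (H \<inter> K') H" "P f K'"
    using insert by blast
  have "\<forall>f'\<in>insert f F. P f' (K \<inter> K')"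
    using K(3) K'(3) assms(4) by (metis Int_lower1 Int_lower2 insert_iff)
  then show ?case
    using normal_Int[OF K(1) K'(1)] finite_index_Int_Int[OF K(2) K'(2)] by blast
qed

text \<open>An element of the closure that lies in \<open>K\<close> factors as
  \<open>k \<otimes> z \<otimes> f\<close>, where \<open>z\<close> lies in \<open>H\<close> and in
  its conjugate by \<open>y\<close>, and \<open>f\<close> is one of finitely many representatives.
  Conjugation keeps \<open>k\<close> in its normal subgroup and takes \<open>z\<close> into
  \<open>H\<close>, so only the images of the \<open>f\<close> have to be controlled, and one
  \<open>K\<close> can do that.\<close>

lemma residual_closure_Int_conj:
  assumes H: "subgroup H G" and y: "y \<in> carrier G"
    and fi: "finite_index G (H \<inter> conj_set G y H) H"
  shows "\<exists>K. K \<lhd> G \<and> finite_index G (H \<inter> K) H \<and>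
    (\<forall>x\<in>residual_closure G H \<inter> K. inv y \<otimes> x \<otimes> y \<in> residual_closure G H)"
proof -
  let ?L = "residual_closure G H"
  let ?c = "\<lambda>x. inv y \<otimes> x \<otimes> y"
  note L = residual_closure_least[OF H]
  have HG: "H \<subseteq> carrier G" and LG: "?L \<subseteq> carrier G"
    using H L(1) subgroup.subset by auto
  obtain F where F: "finite F" "F \<subseteq> H" "\<And>x. x \<in> H \<Longrightarrow> \<exists>f\<in>F. x \<otimes> inv f \<in> H \<inter> conj_set G y H"
    using fi by (rule finite_indexE) blast
  \<comment> \<open>Elements of \<open>?L\<close> lie in every admissible product
    \<open>K <#> H\<close>. For the finitely many elements \<open>?c f\<close>, a single
    \<open>K\<close> gives the converse.\<close>
  have "\<exists>K. K \<lhd> G \<and> finite_index G (H \<inter> K) H \<and> (\<forall>f\<in>F. ?c f \<in> K <#> H \<longrightarrow> ?c f \<in> ?L)"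
  proof (rule normal_finite_index_uniform[OF F(1) H])
    fix f assume "f \<in> F"
    show "\<exists>K. K \<lhd> G \<and> finite_index G (H \<inter> K) H \<and> (?c f \<in> K <#> H \<longrightarrow> ?c f \<in> ?L)"
    proof (cases "?c f \<in> ?L")
      case True
      \<comment> \<open>The empty family merely supplies some admissible \<open>K\<close>.\<close>
      have "\<exists>K. K \<lhd> G \<and> finite_index G (H \<inter> K) H"
        using normal_finite_index_uniform[of "{}" H "\<lambda>_ _. True"] H by simp
      with True show ?thesis
        by blast
    next
      \<comment> \<open>Some admissible \<open>K\<close> has \<open>?c f \<notin> K <#> H\<close>,
        which makes the implication vacuous.\<close>
      case False
      then show ?thesis
        using residual_closure_iff[OF H] by blast
    qed
  next
    fix f K K' assume "?c f \<in> K <#> H \<longrightarrow> ?c f \<in> ?L" "K' \<subseteq> K"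
    then show "?c f \<in> K' <#> H \<longrightarrow> ?c f \<in> ?L"
      using mono_set_mult[of K' K H H] by blast
  qed
  then obtain K where K: "K \<lhd> G" "finite_index G (H \<inter> K) H"
      and KF: "\<And>f. f \<in> F \<Longrightarrow> ?c f \<in> K <#> H \<Longrightarrow> ?c f \<in> ?L"
    by blast
  have "?c x \<in> ?L" if x: "x \<in> ?L" "x \<in> K" for x
  proof -
    have "?c x \<in> K' <#> H" if K': "K' \<lhd> G" "finite_index G (H \<inter> K') H" for K'
    proof -
      \<comment> \<open>Membership of \<open>?c x\<close> in \<open>?L\<close> is tested against an
        arbitrary admissible \<open>K'\<close>. Factoring \<open>x\<close> through
        \<open>K \<inter> K'\<close> puts the same \<open>k\<close> in both: \<open>K\<close> serves
        to control \<open>f\<close>, \<open>K'\<close> to reach the conclusion.\<close>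
      have KK: "K \<inter> K' \<lhd> G" "finite_index G (H \<inter> (K \<inter> K')) H"
        using K K' by (auto intro: normal_Int finite_index_Int_Int)
      then have "x \<in> (K \<inter> K') <#> H"
        using x residual_closure_iff[OF H] by blast
      then obtain k h where kh: "k \<in> K" "k \<in> K'" "h \<in> H" "x = k \<otimes> h"
        by (auto simp: set_mult_def)
      obtain f where f: "f \<in> F" "h \<otimes> inv f \<in> H" "h \<otimes> inv f \<in> conj_set G y H"
        using F kh by blast
      define z where "z = h \<otimes> inv f"
      have KG: "K \<subseteq> carrier G"
        using K(1) normal_imp_subgroup subgroup.subset by blast
      have car: "k \<in> carrier G" "h \<in> carrier G" "f \<in> carrier G" "x \<in> carrier G" "z \<in> carrier G"
        using kh f F HG KG x by (auto simp: z_def)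
      have cz: "?c z \<in> H"
        using f mem_conj_set_iff[OF y car(5) HG] by (simp add: z_def)
      have x_eq: "x = k \<otimes> z \<otimes> f"
        using car by (simp add: kh z_def m_assoc)
      have f_eq: "f = inv z \<otimes> (inv k \<otimes> x)"
        using car by (simp add: x_eq m_assoc inv_mult_cancel)
      have conjK: "?c a \<in> M" if "M \<lhd> G" "a \<in> M" for a M
        using that normal.inv_op_closed1[OF that(1) y] by blast
      \<comment> \<open>Both \<open>k\<close> and \<open>x\<close> lie in \<open>K\<close>, so
        \<open>f\<close> is the product of \<open>inv z\<close>, whose conjugate is in
        \<open>H\<close>, and an element of \<open>K\<close>, whose conjugate stays in
        \<open>K\<close>. Hence \<open>?c f \<in> K <#> H\<close>; the choice of \<open>K\<close>
        then puts \<open>?c f\<close> into \<open>?L\<close>, and so into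
        \<open>K' <#> H\<close>.\<close>
      have "inv k \<otimes> x \<in> K"
        using kh x K by (meson normal_imp_subgroup subgroup.m_closed subgroup.m_inv_closed)
      then have "?c (inv k \<otimes> x) \<in> K <#> H"
        using conjK K(1) subset_mult_left[OF normal_imp_subgroup[OF K(1)] H] by blast
      moreover have "?c (inv z) = inv (?c z)"
        using car y by (simp add: inv_mult_group m_assoc)
      then have "?c (inv z) \<in> K <#> H"
        using cz H subset_mult_right[OF normal_imp_subgroup[OF K(1)] H]
        by (metis subgroup.m_inv_closed subsetD)
      moreover have "?c f = ?c (inv z) \<otimes> ?c (inv k \<otimes> x)"
        unfolding f_eq using car y by (intro conj_mult) auto
      ultimately have "?c f \<in> K <#> H"
        using mult_norm_subgroup[OF K(1) H] by (metis subgroup.m_closed)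
      then have "?c f \<in> K' <#> H"
        using KF[OF f(1)] residual_closure_iff[OF H] K' by blast
      moreover have "?c k \<in> K' <#> H"
        using conjK[OF K'(1) kh(2)] subset_mult_left[OF normal_imp_subgroup[OF K'(1)] H] by blast
      moreover have "?c z \<in> K' <#> H"
        using cz subset_mult_right[OF normal_imp_subgroup[OF K'(1)] H] by blast
      moreover have "?c x = ?c k \<otimes> ?c z \<otimes> ?c f"
        unfolding x_eq using car y by (simp add: conj_mult)
      ultimately show "?c x \<in> K' <#> H"
        using mult_norm_subgroup[OF K'(1) H] by (metis subgroup.m_closed)
    qed
    then show ?thesis
      using residual_closure_iff[OF H] by blast
  qed
  with K show ?thesis
    by blast
qed

section \<open>Normality from the finitely many coset generators\<close>

lemma normal_if_generators_normalize:
  assumes M: "subgroup M G" and S: "S \<subseteq> carrier G" "carrier G = generate G S"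
    and conj: "\<And>s x. s \<in> S \<Longrightarrow> x \<in> M \<Longrightarrow> s \<otimes> x \<otimes> inv s \<in> M \<and> inv s \<otimes> x \<otimes> s \<in> M"
  shows "M \<lhd> G"
proof (rule normal_invI[OF M])
  fix g x assume g: "g \<in> carrier G" and x: "x \<in> M"
  have "g \<in> generate G S"
    using g S(2) by simp
  then show "g \<otimes> x \<otimes> inv g \<in> M"
    using x
  proof (induction arbitrary: x rule: generate.induct)
    case one
    then show ?case
      using subgroup.subset[OF M] by auto
  next
    case (incl h)
    then show ?case
      using conj by blast
  next
    \<comment> \<open>\<open>generate\<close> also adjoins inverses. In an infinite group,
      invariance under conjugation by \<open>s\<close> need not give invariance under
      \<open>inv s\<close>, hence the two halves of \<open>conj\<close>.\<close>
    case (inv h)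
    then show ?case
      using conj S(1) by auto
  next
    case (eng a b)
    then have "a \<in> carrier G" "b \<in> carrier G" "x \<in> carrier G"
      using S subgroup.subset[OF M] by auto
    then have "a \<otimes> b \<otimes> x \<otimes> inv (a \<otimes> b) = a \<otimes> (b \<otimes> x \<otimes> inv b) \<otimes> inv a"
      by (simp add: inv_mult_group m_assoc)
    then show ?case
      using eng by simp
  qed
qed

text \<open>Elements of \<open>H\<close> lie in the closure and normalise every normal
  \<open>K\<close>, so they conjugate \<open>residual_closure G H \<inter> K\<close> into itself. Of
  a generator \<open>y \<otimes> h\<close> only \<open>y\<close> is left to treat, and a common
  admissible \<open>K\<close> handles the finitely many \<open>y\<close>.\<close>

lemma exists_normal_Int_residual_closure:
  assumes H: "subgroup H G" and "commensurated G H"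
    and "generated_by_finitely_many_cosets G H"
  shows "\<exists>K. K \<lhd> G \<and> finite_index G (H \<inter> K) H \<and> residual_closure G H \<inter> K \<lhd> G"
proof -
  let ?L = "residual_closure G H"
  note L = residual_closure_least[OF H]
  obtain Y where Y: "finite Y" "Y \<subseteq> carrier G" and gen: "carrier G = generate G (Y <#> H)"
    using assms(3) by (auto simp: generated_by_finitely_many_cosets_def)
  \<comment> \<open>Adding the inverses lets \<open>KZ\<close> cover conjugation by \<open>y\<close>
    in both directions.\<close>
  define Z where "Z = Y \<union> (\<lambda>y. inv y) ` Y"
  have Z: "finite Z" "Z \<subseteq> carrier G"
    using Y by (auto simp: Z_def)
  have "\<exists>K. K \<lhd> G \<and> finite_index G (H \<inter> K) H \<and>
      (\<forall>y\<in>Z. \<forall>x\<in>?L \<inter> K. inv y \<otimes> x \<otimes> y \<in> ?L)"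
  proof (rule normal_finite_index_uniform[OF Z(1) H])
    fix y assume "y \<in> Z"
    then show "\<exists>K. K \<lhd> G \<and> finite_index G (H \<inter> K) H \<and> (\<forall>x\<in>?L \<inter> K. inv y \<otimes> x \<otimes> y \<in> ?L)"
      using assms(2) Z by (intro residual_closure_Int_conj[OF H]) (auto simp: commensurated_def)
  qed blast
  then obtain K where K: "K \<lhd> G" "finite_index G (H \<inter> K) H"
      and KZ: "\<And>y x. y \<in> Z \<Longrightarrow> x \<in> ?L \<inter> K \<Longrightarrow> inv y \<otimes> x \<otimes> y \<in> ?L"
    by blast
  have HG: "H \<subseteq> carrier G" and LG: "?L \<subseteq> carrier G"
    using H L(1) subgroup.subset by auto
  have conjK: "g \<otimes> x \<otimes> inv g \<in> K" "inv g \<otimes> x \<otimes> g \<in> K"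
    if "g \<in> carrier G" "x \<in> K" for g x
    using normal.inv_op_closed1[OF K(1) that] normal.inv_op_closed2[OF K(1) that] by blast+
  have conjH: "h \<otimes> x \<otimes> inv h \<in> ?L \<inter> K" "inv h \<otimes> x \<otimes> h \<in> ?L \<inter> K"
    if "h \<in> H" "x \<in> ?L \<inter> K" for h x
    using that conjK HG L(1,3)
    by (auto intro!: subgroup.m_closed[OF L(1)] subgroup.m_inv_closed[OF L(1)])
  have conjY: "y \<otimes> x \<otimes> inv y \<in> ?L \<inter> K" "inv y \<otimes> x \<otimes> y \<in> ?L \<inter> K"
    if "y \<in> Y" "x \<in> ?L \<inter> K" for y x
    using that conjK[of y x] KZ[of y x] KZ[of "inv y" x] Y by (auto simp: Z_def)
  have "?L \<inter> K \<lhd> G"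
  proof (rule normal_if_generators_normalize[OF _ _ gen])
    show "subgroup (?L \<inter> K) G"
      using L(1) normal_imp_subgroup[OF K(1)] by (rule subgroups_Inter_pair)
    show "Y <#> H \<subseteq> carrier G"
      using Y(2) HG by (rule set_mult_closed)
    fix s x assume "s \<in> Y <#> H" and x: "x \<in> ?L \<inter> K"
    then obtain y h where yh: "y \<in> Y" "h \<in> H" "s = y \<otimes> h"
      by (auto simp: set_mult_def)
    have car: "y \<in> carrier G" "h \<in> carrier G" "x \<in> carrier G"
      using yh Y HG LG x by auto
    have "s \<otimes> x \<otimes> inv s = y \<otimes> (h \<otimes> x \<otimes> inv h) \<otimes> inv y"
      "inv s \<otimes> x \<otimes> s = inv h \<otimes> (inv y \<otimes> x \<otimes> y) \<otimes> h"
      using car by (simp_all add: yh(3) inv_mult_group m_assoc)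
    then show "s \<otimes> x \<otimes> inv s \<in> ?L \<inter> K \<and> inv s \<otimes> x \<otimes> s \<in> ?L \<inter> K"
      using yh x conjH conjY by metis
  qed
  with K show ?thesis
    by blast
qed

section \<open>The normal core and the residual closure of its intersection with
  \<open>H\<close>\<close>

lemma normal_Inter_conj_set:
  assumes L: "subgroup L G"
  shows "(\<Inter>g\<in>carrier G. conj_set G g L) \<lhd> G" (is "?N \<lhd> G")
    and "\<And>x. x \<in> (\<Inter>g\<in>carrier G. conj_set G g L) \<longleftrightarrow>
      x \<in> carrier G \<and> (\<forall>g\<in>carrier G. inv g \<otimes> x \<otimes> g \<in> L)"
proof -
  have LG: "L \<subseteq> carrier G"
    using L by (rule subgroup.subset)
  \<comment> \<open>The index set contains \<open>\<one>\<close>, so members of the intersection lie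
    in \<open>carrier G\<close>.\<close>
  show iff: "x \<in> ?N \<longleftrightarrow> x \<in> carrier G \<and> (\<forall>g\<in>carrier G. inv g \<otimes> x \<otimes> g \<in> L)" for x
    using conj_set_subset_carrier[OF one_closed LG] mem_conj_set_iff[OF _ _ LG] by blast
  have car: "x \<in> carrier G" and cl: "\<And>g. g \<in> carrier G \<Longrightarrow> inv g \<otimes> x \<otimes> g \<in> L" if "x \<in> ?N" for x
    using that unfolding iff by blast+
  show "?N \<lhd> G"
  proof (rule normal_invI)
    show "subgroup ?N G"
    proof (rule subgroupI)
      show "?N \<subseteq> carrier G"
        using car by blast
      have "\<one> \<in> ?N"
        unfolding iff using subgroup.one_closed[OF L] by simp
      then show "?N \<noteq> {}"
        by blast
      show "inv a \<in> ?N" if a: "a \<in> ?N" for a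
        unfolding iff
      proof (intro conjI ballI)
        fix g assume g: "g \<in> carrier G"
        have "inv g \<otimes> inv a \<otimes> g = inv (inv g \<otimes> a \<otimes> g)"
          using car[OF a] g by (simp add: inv_mult_group m_assoc)
        then show "inv g \<otimes> inv a \<otimes> g \<in> L"
          using cl[OF a g] subgroup.m_inv_closed[OF L] by simp
      qed (use car[OF a] in simp)
      show "a \<otimes> b \<in> ?N" if a: "a \<in> ?N" and b: "b \<in> ?N" for a b
        unfolding iff using car[OF a] car[OF b] cl[OF a] cl[OF b]
        by (auto simp: conj_mult intro: subgroup.m_closed[OF L])
    qed
    fix h x assume h: "h \<in> carrier G" and x: "x \<in> ?N"
    show "h \<otimes> x \<otimes> inv h \<in> ?N"
      unfolding iff
    proof (intro conjI ballI)
      fix g assume g: "g \<in> carrier G"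
      \<comment> \<open>Conjugation by \<open>h\<close> permutes the conjugates of \<open>L\<close>:
        the conjugator \<open>g\<close> turns into \<open>inv h \<otimes> g\<close>.\<close>
      have "inv g \<otimes> (h \<otimes> x \<otimes> inv h) \<otimes> g = inv (inv h \<otimes> g) \<otimes> x \<otimes> (inv h \<otimes> g)"
        using car[OF x] g h by (simp add: inv_mult_group m_assoc)
      then show "inv g \<otimes> (h \<otimes> x \<otimes> inv h) \<otimes> g \<in> L"
        using cl[OF x, of "inv h \<otimes> g"] g h by simp
    qed (use car[OF x] h in simp)
  qed
qed

text \<open>\<open>N\<close> is virtually normal, which gives one inclusion. For the other,
  admissibility of \<open>K \<inter> N\<close> yields
  \<open>N \<subseteq> (K \<inter> N) <#> H\<close>, and Dedekind's modular argument forces the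
  factor from \<open>H\<close> into \<open>N \<inter> H\<close>, hence into
  \<open>J\<close>.\<close>

lemma residual_closure_normal_Int:
  assumes H: "subgroup H G" and N: "N \<lhd> G" and fi: "finite_index G (N \<inter> H) H"
    and NL: "N \<subseteq> residual_closure G H"
  shows "N = residual_closure G (N \<inter> H)"
proof
  have Ns: "subgroup N G"
    using N by (rule normal_imp_subgroup)
  have "finite_index G N N"
    using subgroup.one_closed[OF Ns] subgroup.subset[OF Ns]
    by (intro finite_indexI[OF Ns Ns, of "{\<one>}"]) auto
  then have "virtually_normal G N"
    using N Ns by (auto simp: virtually_normal_def)
  then show "residual_closure G (N \<inter> H) \<subseteq> N"
    by (auto simp: residual_closure_def)
  show "N \<subseteq> residual_closure G (N \<inter> H)"
    unfolding residual_closure_def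
  proof (intro Inter_greatest, elim CollectE conjE)
    fix J assume "virtually_normal G J" and NJ: "N \<inter> H \<subseteq> J"
    then obtain K where K: "K \<lhd> G" "finite_index G K J"
      by (auto simp: virtually_normal_def)
    then have J: "subgroup J G" "K \<subseteq> J"
      by (auto simp: finite_index_def)
    have "finite_index G (N \<inter> H \<inter> K) (N \<inter> H)"
      using K(2) subgroups_Inter_pair[OF Ns H] NJ by (rule finite_index_Int)
    \<comment> \<open>The tower runs from \<open>N \<inter> H \<inter> K\<close> through
      \<open>N \<inter> H\<close> up to \<open>H\<close>.\<close>
    then have "finite_index G (H \<inter> (K \<inter> N)) H"
      using finite_index_trans[OF _ fi] by (simp add: Int_ac)
    then have NKH: "N \<subseteq> (K \<inter> N) <#> H"
      using NL residual_closure_iff[OF H] normal_Int[OF K(1) N] by blast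
    show "N \<subseteq> J"
    proof
      fix x assume x: "x \<in> N"
      then obtain k h where kh: "k \<in> K" "k \<in> N" "h \<in> H" "x = k \<otimes> h"
        using NKH by (auto simp: set_mult_def)
      have "k \<in> carrier G" "h \<in> carrier G"
        using kh Ns H by (meson subgroup.mem_carrier subsetD)+
      then have "h = inv k \<otimes> x"
        by (simp add: kh inv_mult_cancel)
      then have "h \<in> N"
        using kh x Ns by (metis subgroup.m_closed subgroup.m_inv_closed)
      then show "x \<in> J"
        using kh J NJ by (auto intro: subgroup.m_closed)
    qed
  qed
qed

end

theorem mainTheorem1:
  fixes G :: "('a, 'b) monoid_scheme" (structure)
    and H N :: "'a set"
  assumes "group G"
    and "subgroup H G"
    and "commensurated G H"
    and "generated_by_finitely_many_cosets G H"
    and "N = (\<Inter>g\<in>carrier G. conj_set G g (residual_closure G H))"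
  shows "finite_index G N (residual_closure G H)
    \<and> N \<lhd> G
    \<and> finite_index G (N \<inter> H) H
    \<and> N = residual_closure G (N \<inter> H)
    \<and> residual_closure G H = N <#> H"
proof -
  interpret group G
    by fact
  let ?L = "residual_closure G H"
  note H = assms(2)
  note L = residual_closure_least[OF H]
  have N: "N \<lhd> G"
    and N_iff: "\<And>x. x \<in> N \<longleftrightarrow> x \<in> carrier G \<and> (\<forall>g\<in>carrier G. inv g \<otimes> x \<otimes> g \<in> ?L)"
    using normal_Inter_conj_set[OF L(1)] unfolding assms(5) by blast+
  have Ns: "subgroup N G"
    using N by (rule normal_imp_subgroup)
  \<comment> \<open>Conjugation by \<open>\<one>\<close> is the identity.\<close>
  have NL: "N \<subseteq> ?L"
    using N_iff[THEN iffD1] by force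
  obtain K where K: "K \<lhd> G" "finite_index G (H \<inter> K) H" and M: "?L \<inter> K \<lhd> G"
    using exists_normal_Int_residual_closure[OF H assms(3,4)] by blast
  \<comment> \<open>\<open>K\<close> has finite index in \<open>K <#> H\<close>, so
    \<open>?L \<inter> K\<close> has finite index in \<open>?L\<close>. Being normal in
    \<open>G\<close> and contained in \<open>?L\<close>, it lies in the core \<open>N\<close>, which
    is thus caught between it and \<open>?L\<close>.\<close>
  have "?L \<subseteq> K <#> H"
    using residual_closure_iff[OF H] K by blast
  then have "finite_index G (?L \<inter> K) ?L"
    using finite_index_Int[OF finite_index_normal_mult[OF K] L(1)] by blast
  moreover have "?L \<inter> K \<subseteq> N"
    using M normal.inv_op_closed1[OF M] subgroup.subset[OF L(1)] by (auto simp: N_iff)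
  ultimately have fi: "finite_index G N ?L"
    using finite_index_mono Ns NL by blast
  then have fiH: "finite_index G (H \<inter> N) H"
    using finite_index_Int H L(3) by blast
  then have fiH': "finite_index G (N \<inter> H) H"
    by (simp add: Int_commute)
  have "?L = N <#> H"
  proof
    \<comment> \<open>By \<open>fiH\<close>, \<open>N\<close> itself is now admissible.\<close>
    show "?L \<subseteq> N <#> H"
      using residual_closure_iff[OF H] N fiH by blast
    show "N <#> H \<subseteq> ?L"
      using L(1) NL L(3) by (rule subgroup_mult_least)
  qed
  then show ?thesis
    using fi N fiH' residual_closure_normal_Int[OF H N fiH' NL] by blast
qed

end
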